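(* Let $\varphi,\psi$ be holomorphic functions from the open unit disk $\mathbb{D}$ to $\mathbb{C}$ with Taylor expansions $\varphi(z)=\sum_{k=1}^{\infty}\alpha_kz^k$ and $\psi(z)=\sum_{k=0}^{\infty}\beta_kz^k$, where $\alpha_1\neq 0$ and $\beta_0\neq0$. Let $F(z)=\varphi(z)\psi(\omega(z))$ for $z\in\mathbb{D}$, where $\omega$ is a holomorphic self-mapping of $\mathbb{D}$ with $\omega(z)=\sum_{k=1}^{\infty}c_kz^k$ (so $\omega(0)=0$), and write $F(z)=\sum_{k=0}^\infty a_kz^k$. Denote $b:=\frac{1}{\alpha_1\beta_0}$. Then $a_1=\frac{1}{b}$ and $$a_p=\alpha_p\beta_0+\sum_{m=1}^{p-1}\sum_{k=1}^{m}\alpha_{p-m}\beta_kB_{m,k}^o\left(c_1,\ldots,c_{m-k+1}\right),\quad p\ge2.$$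
   Context: For $1\le k\le n$ the ordinary Bell polynomials are $$B^o_{n,k}(x_{1},x_{2},\dots ,x_{n-k+1})=k!\sum_{j \in I_k}\prod_{i=1}^{n-k+1} \frac{x_i^{j_{i}} }{j_{i}!},$$ where $I_k$ consists of all multi-indices $j=(j_1,\ldots,j_{n-k+1})$ of non-negative integers with $\sum_{i=1}^{n-k+1} i j_i=n$ and $\sum_{i=1}^{n-k+1} j_i=k$. *)

theory Defs
  imports "HOL-Complex_Analysis.Complex_Analysis"
begin

text \<open>
  Multi-indices \<open>(j\<^sub>1, \<dots>, j\<^sub>n\<^sub>-\<^sub>k\<^sub>+\<^sub>1)\<close> are represented by functions that are \<open>undefined\<close> outside
  \<open>{1..n - k + 1}\<close>, so that each multi-index is counted exactly once.
\<close>

definition bell_indices :: "nat \<Rightarrow> nat \<Rightarrow> (nat \<Rightarrow> nat) set" where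
  "bell_indices n k =
     {j \<in> {1..n - k + 1} \<rightarrow>\<^sub>E UNIV.
        (\<Sum>i = 1..n - k + 1. i * j i) = n \<and> (\<Sum>i = 1..n - k + 1. j i) = k}"

text \<open>
  The ordinary Bell polynomials, meant for \<open>1 \<le> k \<le> n\<close>. The arguments are given by a sequence
  \<open>x\<close>, of which only \<open>x 1, \<dots>, x (n - k + 1)\<close> are used.
\<close>

definition ordinary_bell :: "nat \<Rightarrow> nat \<Rightarrow> (nat \<Rightarrow> 'a :: field_char_0) \<Rightarrow> 'a" where
  "ordinary_bell n k x =
     fact k * (\<Sum>j\<in>bell_indices n k. \<Prod>i = 1..n - k + 1. x i ^ j i / fact (j i))"

lemma finite_bell_indices: "finite (bell_indices n k)"
proof (rule finite_subset)
  show "bell_indices n k \<subseteq> {1..n - k + 1} \<rightarrow>\<^sub>E {..k}"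
  proof
    fix j assume j: "j \<in> bell_indices n k"
    have "j i \<le> k" if "i \<in> {1..n - k + 1}" for i
      using member_le_sum[of i "{1..n - k + 1}" j] that j
      by (simp add: bell_indices_def)
    then show "j \<in> {1..n - k + 1} \<rightarrow>\<^sub>E {..k}"
      using j by (auto simp: bell_indices_def PiE_def)
  qed
qed (simp add: finite_PiE)

end

theory Submission
  imports Defs
begin

text \<open>
  On power series the claim is a computation. The Taylor series of \<open>F\<close> at \<open>0\<close> is
  \<open>\<Phi> * (\<Psi> oo W)\<close>, where \<open>\<Phi>\<close>, \<open>\<Psi>\<close>, \<open>W\<close> are the Taylor series of \<open>\<phi>\<close>, \<open>\<psi>\<close>, \<open>\<omega>\<close>; the
  composition makes sense because \<open>W\<close> has no constant term. Its coefficient of order \<open>m \<ge> 1\<close> is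
  \<open>(\<Psi> oo W)\<^sub>m = (\<Sum>k = 1..m. \<beta> k * (W ^ k)\<^sub>m)\<close>, and the Cauchy product with \<open>\<Phi>\<close>, which starts in
  degree \<open>1\<close>, gives the double sum. The term \<open>\<alpha> p * \<beta> 0\<close> is the contribution of \<open>m = 0\<close>.

  What remains is that \<open>(W ^ k)\<^sub>m\<close> is the ordinary Bell polynomial in the coefficients of \<open>W\<close>
  (\<open>fps_power_nth_eq_ordinary_bell\<close>). A product of \<open>k\<close> factors of order at least \<open>1\<close> has total
  degree \<open>m\<close> only if every factor has degree at most \<open>m - k + 1\<close>, so \<open>W\<close> may be replaced by a
  polynomial with the monomials \<open>X, \<dots>, X\<^sup>m\<^sup>-\<^sup>k\<^sup>+\<^sup>1\<close>. Its power is expanded by the multinomial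
  theorem, which takes its simplest form for the divided powers \<open>f ^ k / k!\<close>
  (\<open>fps_divided_power_sum\<close>): the multi-indices with \<open>j\<^sub>1 + j\<^sub>2 + \<dots> = k\<close> number the terms, and
  extracting the coefficient of \<open>X\<^sup>m\<close> imposes the second condition \<open>1 j\<^sub>1 + 2 j\<^sub>2 + \<dots> = m\<close>.
\<close>

section \<open>The multinomial theorem for divided powers\<close>

text \<open>
  The multi-indices are \<open>undefined\<close> outside \<open>A\<close> to agree with \<^term>\<open>bell_indices n k\<close>, which is
  cut out of \<open>weak_compositions {1..n - k + 1} k\<close> by the condition \<open>(\<Sum>i. i * j i) = n\<close>.
\<close>

definition weak_compositions :: "'i set \<Rightarrow> nat \<Rightarrow> ('i \<Rightarrow> nat) set" where
  "weak_compositions A k = {j \<in> A \<rightarrow>\<^sub>E UNIV. sum j A = k}"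

lemma finite_weak_compositions:
  assumes "finite A"
  shows "finite (weak_compositions A k)"
proof (rule finite_subset)
  show "weak_compositions A k \<subseteq> A \<rightarrow>\<^sub>E {..k}"
  proof
    fix j assume j: "j \<in> weak_compositions A k"
    have "j i \<le> k" if "i \<in> A" for i
      using member_le_sum[of i A j] that j assms by (simp add: weak_compositions_def)
    then show "j \<in> A \<rightarrow>\<^sub>E {..k}"
      using j by (auto simp: weak_compositions_def PiE_def)
  qed
qed (simp add: assms finite_PiE)

text \<open>
  The value \<open>l\<close> at the new point can be split off: this is the recursion that matches the binomial
  expansion of \<open>(f + g) ^ k\<close> in the induction below.
\<close>

lemma weak_compositions_insert:
  assumes "finite A" "x \<notin> A"
  shows "bij_betw (\<lambda>(l, j). j(x := l)) (SIGMA l:{..k}. weak_compositions A (k - l))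
           (weak_compositions (insert x A) k)"
proof (rule bij_betwI[where g = "\<lambda>j. (j x, j(x := undefined))"])
  have upd: "(\<Sum>i\<in>A. if i = x then l else j i) = sum j A" for j :: "'a \<Rightarrow> nat" and l
    using assms by (intro sum.cong) auto
  show "(\<lambda>(l, j). j(x := l)) \<in> (SIGMA l:{..k}. weak_compositions A (k - l)) \<rightarrow>
          weak_compositions (insert x A) k"
    using assms by (auto simp: weak_compositions_def upd PiE_iff extensional_def)
  show "(\<lambda>j. (j x, j(x := undefined))) \<in> weak_compositions (insert x A) k \<rightarrow>
          (SIGMA l:{..k}. weak_compositions A (k - l))"
    using assms by (auto simp: weak_compositions_def upd PiE_iff extensional_def)
qed (use assms in \<open>auto simp: weak_compositions_def PiE_iff extensional_def\<close>)

definition fps_divided_power :: "'a :: field_char_0 fps \<Rightarrow> nat \<Rightarrow> 'a fps" where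
  "fps_divided_power f k = fps_const (1 / fact k) * f ^ k"

lemma fps_divided_power_0_left: "fps_divided_power 0 k = (if k = 0 then 1 else 0)"
  by (simp add: fps_divided_power_def)

text \<open>
  With the factorials absorbed into the powers, the binomial theorem loses its coefficients and
  becomes a plain convolution. This is what lets it be iterated over any number of summands.
\<close>

lemma fps_divided_power_add:
  "fps_divided_power (f + g) k = (\<Sum>l\<le>k. fps_divided_power f l * fps_divided_power g (k - l))"
proof -
  have coeff: "1 / fact k * of_nat (k choose l) = 1 / fact l * (1 / fact (k - l) :: 'a)"
    if "l \<le> k" for l
    using that by (simp add: binomial_fact)
  have "fps_divided_power (f + g) k =
      (\<Sum>l\<le>k. fps_const (1 / fact k * of_nat (k choose l)) * (f ^ l * g ^ (k - l)))"
    by (simp only: fps_divided_power_def binomial_ring sum_distrib_left fps_of_nat[symmetric]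
        mult.assoc fps_const_mult[symmetric])
  also have "\<dots> = (\<Sum>l\<le>k. fps_divided_power f l * fps_divided_power g (k - l))"
  proof (rule sum.cong)
    fix l assume "l \<in> {..k}"
    then have "fps_const (1 / fact k * of_nat (k choose l) :: 'a) =
        fps_const (1 / fact l) * fps_const (1 / fact (k - l))"
      by (simp only: coeff atMost_iff fps_const_mult)
    then show "fps_const (1 / fact k * of_nat (k choose l)) * (f ^ l * g ^ (k - l)) =
        fps_divided_power f l * fps_divided_power g (k - l)"
      by (simp only: fps_divided_power_def mult_ac)
  qed simp
  finally show ?thesis .
qed

text \<open>
  The multinomial theorem: multiplied by \<open>k!\<close>, the factors \<open>1 / (j i)!\<close> of a term combine to its
  multinomial coefficient.
\<close>

lemma fps_divided_power_sum:
  fixes f :: "'i \<Rightarrow> 'a :: field_char_0 fps"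
  assumes "finite A"
  shows "fps_divided_power (\<Sum>i\<in>A. f i) k =
    (\<Sum>j\<in>weak_compositions A k. \<Prod>i\<in>A. fps_divided_power (f i) (j i))"
  using assms
proof (induction A arbitrary: k rule: finite_induct)
  case empty
  have "weak_compositions ({} :: 'i set) k = (if k = 0 then {\<lambda>_. undefined} else {})"
    by (auto simp: weak_compositions_def)
  then show ?case by (simp add: fps_divided_power_0_left)
next
  case (insert x A)
  have upd: "(\<Prod>i\<in>A. fps_divided_power (f i) (if i = x then l else j i)) =
      (\<Prod>i\<in>A. fps_divided_power (f i) (j i))" for j l
    using insert.hyps by (intro prod.cong) auto
  have "fps_divided_power (\<Sum>i\<in>insert x A. f i) k =
      (\<Sum>l\<le>k. \<Sum>j\<in>weak_compositions A (k - l).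
         fps_divided_power (f x) l * (\<Prod>i\<in>A. fps_divided_power (f i) (j i)))"
    using insert by (simp add: fps_divided_power_add sum_distrib_left)
  also have "\<dots> = (\<Sum>(l, j)\<in>(SIGMA l:{..k}. weak_compositions A (k - l)).
         \<Prod>i\<in>insert x A. fps_divided_power (f i) ((j(x := l)) i))"
    using insert.hyps by (simp add: sum.Sigma finite_weak_compositions upd)
  also have "\<dots> = (\<Sum>j\<in>weak_compositions (insert x A) k.
         \<Prod>i\<in>insert x A. fps_divided_power (f i) (j i))"
    using sum.reindex_bij_betw[OF weak_compositions_insert[OF insert.hyps(1,2)],
        where g = "\<lambda>j. \<Prod>i\<in>insert x A. fps_divided_power (f i) (j i)"]
    by (simp only: case_prod_unfold)
  finally show ?case .
qed

section \<open>Ordinary Bell polynomials as coefficients of powers\<close>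

lemma fps_power_nth_cong:
  fixes f g :: "'a :: comm_ring_1 fps"
  assumes "\<And>i. i \<le> m \<Longrightarrow> fps_nth f i = fps_nth g i" and "i \<le> m"
  shows "fps_nth (f ^ k) i = fps_nth (g ^ k) i"
  using assms(2)
proof (induction k arbitrary: i)
  case (Suc k)
  then show ?case by (auto simp: fps_mult_nth assms(1) intro!: sum.cong)
qed simp

lemma fps_const_X_power_prod:
  "(\<Prod>i\<in>A. fps_const (u i) * fps_X ^ w i) = fps_const (\<Prod>i\<in>A. u i) * fps_X ^ (\<Sum>i\<in>A. w i)"
  for u :: "'i \<Rightarrow> 'a :: comm_ring_1"
  by (induction A rule: infinite_finite_induct) (simp_all add: power_add mult_ac flip: fps_const_mult)

text \<open>
  In the multinomial expansion every term is a single monomial, of degree \<open>\<Sum>i. i * j i\<close>. Hence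
  the coefficient of order \<open>n\<close> collects exactly the multi-indices in \<^term>\<open>bell_indices n k\<close>.
\<close>

lemma ordinary_bell_eq_fps_power_nth_truncated:
  fixes x :: "nat \<Rightarrow> 'a :: field_char_0"
  shows "ordinary_bell n k x =
     fps_nth ((\<Sum>i = 1..n - k + 1. fps_const (x i) * fps_X ^ i) ^ k) n"
proof -
  let ?A = "{1..n - k + 1}"
  let ?f = "\<lambda>i. fps_const (x i) * fps_X ^ i"
  have "fps_divided_power (?f i) l = fps_const (x i ^ l / fact l) * fps_X ^ (i * l)" for i l
    by (simp add: fps_divided_power_def power_mult_distrib power_mult flip: mult.assoc)
  then have mono: "(\<Prod>i\<in>?A. fps_divided_power (?f i) (j i)) =
      fps_const (\<Prod>i\<in>?A. x i ^ j i / fact (j i)) * fps_X ^ (\<Sum>i\<in>?A. i * j i)" for j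
    by (simp add: fps_const_X_power_prod)
  have "fps_nth ((\<Sum>i\<in>?A. ?f i) ^ k) n = fact k * fps_nth (fps_divided_power (\<Sum>i\<in>?A. ?f i) k) n"
    by (simp add: fps_divided_power_def)
  also have "\<dots> = fact k * (\<Sum>j\<in>weak_compositions ?A k.
      if n = (\<Sum>i\<in>?A. i * j i) then \<Prod>i\<in>?A. x i ^ j i / fact (j i) else 0)"
    by (simp only: fps_divided_power_sum[OF finite_atLeastAtMost] mono fps_sum_nth
        fps_mult_left_const_nth fps_X_power_nth if_distrib mult_1_right mult_zero_right)
  also have "(\<Sum>j\<in>weak_compositions ?A k.
      if n = (\<Sum>i\<in>?A. i * j i) then \<Prod>i\<in>?A. x i ^ j i / fact (j i) else 0) =
      (\<Sum>j\<in>bell_indices n k. \<Prod>i\<in>?A. x i ^ j i / fact (j i))"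
    by (subst sum.inter_filter[OF finite_weak_compositions, symmetric])
      (auto simp: weak_compositions_def bell_indices_def intro!: sum.cong)
  finally show ?thesis by (simp add: ordinary_bell_def)
qed

text \<open>
  Writing \<open>W = X V\<close> gives \<open>W ^ k = X ^ k V ^ k\<close>, so the coefficient of order \<open>n\<close> of \<open>W ^ k\<close> is
  that of order \<open>n - k\<close> of \<open>V ^ k\<close>. It depends only on the coefficients of \<open>V\<close> up to \<open>n - k\<close>, that
  is, on those of \<open>W\<close> up to \<open>n - k + 1\<close>, which is why the Bell polynomial stops at that argument.
\<close>

lemma fps_power_nth_eq_ordinary_bell:
  fixes W :: "'a :: field_char_0 fps"
  assumes "fps_nth W 0 = 0" and "k \<le> n"
  shows "fps_nth (W ^ k) n = ordinary_bell n k (fps_nth W)"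
proof -
  define T where "T = (\<Sum>i = 1..n - k + 1. fps_const (fps_nth W i) * fps_X ^ i)"
  have T: "fps_nth T i = (if i \<in> {1..n - k + 1} then fps_nth W i else 0)" for i
    by (simp del: sum.cl_ivl_Suc add: T_def fps_sum_nth if_distrib cong: if_cong)
  have X: "fps_nth (g ^ k) n = fps_nth (fps_shift 1 g ^ k) (n - k)"
    if "fps_nth g 0 = 0" for g :: "'a fps"
  proof -
    have "g = fps_X * fps_shift 1 g"
      using that by (auto simp: fps_eq_iff)
    then have "g ^ k = fps_X ^ k * fps_shift 1 g ^ k"
      by (metis power_mult_distrib)
    then show ?thesis
      using \<open>k \<le> n\<close> by (simp add: fps_X_power_mult_nth)
  qed
  have "fps_nth (fps_shift 1 W ^ k) (n - k) = fps_nth (fps_shift 1 T ^ k) (n - k)"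
    by (rule fps_power_nth_cong[of "n - k"]) (auto simp: T)
  then have "fps_nth (W ^ k) n = fps_nth (T ^ k) n"
    using assms by (simp add: X T)
  then show ?thesis
    by (simp add: ordinary_bell_eq_fps_power_nth_truncated T_def)
qed

section \<open>Taylor coefficients of the composition\<close>

text \<open>
  Convergence at the points of a disk bounds the radius of convergence from below. This turns the
  pointwise expansions of the theorem into ones that can be multiplied, composed and compared.
\<close>

lemma has_fps_expansion_of_sums:
  fixes f :: "complex \<Rightarrow> complex"
  assumes "r > 0" and sums: "\<And>z. z \<in> ball 0 r \<Longrightarrow> (\<lambda>k. u k * z ^ k) sums f z"
  shows "f has_fps_expansion Abs_fps u"
proof -
  have "conv_radius u \<ge> ereal r"
  proof (rule conv_radius_geI_ex')
    fix s assume "0 < s" "ereal s < ereal r"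
    then show "summable (\<lambda>n. u n * of_real s ^ n)"
      using sums[of "of_real s"] by (auto simp: sums_iff)
  qed
  then have "fps_conv_radius (Abs_fps u) > 0"
    using \<open>r > 0\<close> by (auto simp: fps_conv_radius_def zero_ereal_def intro: less_le_trans[of _ "ereal r"])
  moreover have "eventually (\<lambda>z. eval_fps (Abs_fps u) z = f z) (nhds 0)"
    using eventually_nhds_in_open[of "ball 0 r" 0] \<open>r > 0\<close>
    by (auto elim!: eventually_mono simp: eval_fps_def sums_unique[OF sums, symmetric])
  ultimately show ?thesis by (simp add: has_fps_expansion_def)
qed

theorem theorem4p1:
  fixes \<phi> \<psi> \<omega> F :: "complex \<Rightarrow> complex"
    and \<alpha> \<beta> c a :: "nat \<Rightarrow> complex"
    and b :: complex
  assumes "\<phi> holomorphic_on ball 0 1"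
    and "\<psi> holomorphic_on ball 0 1"
    and "\<And>z. z \<in> ball 0 1 \<Longrightarrow> (\<lambda>k. \<alpha> (Suc k) * z ^ Suc k) sums \<phi> z"
    and "\<And>z. z \<in> ball 0 1 \<Longrightarrow> (\<lambda>k. \<beta> k * z ^ k) sums \<psi> z"
    and "\<alpha> 1 \<noteq> 0"
    and "\<beta> 0 \<noteq> 0"
    and "\<omega> holomorphic_on ball 0 1"
    and "\<omega> ` ball 0 1 \<subseteq> ball 0 1"
    and "\<And>z. z \<in> ball 0 1 \<Longrightarrow> (\<lambda>k. c (Suc k) * z ^ Suc k) sums \<omega> z"
    and "\<And>z. z \<in> ball 0 1 \<Longrightarrow> F z = \<phi> z * \<psi> (\<omega> z)"
    and "\<And>z. z \<in> ball 0 1 \<Longrightarrow> (\<lambda>k. a k * z ^ k) sums F z"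
    and "b = 1 / (\<alpha> 1 * \<beta> 0)"
  shows "a 1 = 1 / b \<and>
    (\<forall>p\<ge>2. a p = \<alpha> p * \<beta> 0 +
       (\<Sum>m = 1..p - 1. \<Sum>k = 1..m. \<alpha> (p - m) * \<beta> k * ordinary_bell m k c))"
proof -
  \<comment> \<open>The values \<open>\<alpha> 0\<close> and \<open>c 0\<close> are arbitrary; the expansions start in degree 1.\<close>
  define \<Phi> \<Psi> W where "\<Phi> = Abs_fps (\<alpha>(0 := 0))" and "\<Psi> = Abs_fps \<beta>" and "W = Abs_fps (c(0 := 0))"
  have sums0: "(\<lambda>k. (u(0 := 0)) k * z ^ k) sums s" if "(\<lambda>k. u (Suc k) * z ^ Suc k) sums s"
    for u :: "nat \<Rightarrow> complex" and z s
    using that sums_Suc_iff[of "\<lambda>k. (u(0 := 0)) k * z ^ k" s] by simp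
  have "\<phi> has_fps_expansion \<Phi>" "\<psi> has_fps_expansion \<Psi>" "\<omega> has_fps_expansion W"
    unfolding \<Phi>_def \<Psi>_def W_def
    by (rule has_fps_expansion_of_sums[of 1]; use assms in \<open>blast intro: sums0 zero_less_one\<close>)+
  then have "(\<lambda>z. \<phi> z * (\<psi> \<circ> \<omega>) z) has_fps_expansion \<Phi> * (\<Psi> oo W)"
    by (intro has_fps_expansion_mult has_fps_expansion_compose) (simp_all add: W_def)
  moreover have "eventually (\<lambda>z. \<phi> z * (\<psi> \<circ> \<omega>) z = F z) (nhds 0)"
    using eventually_nhds_in_open[of "ball 0 1" 0]
    by (auto elim!: eventually_mono simp: assms(10))
  ultimately have "F has_fps_expansion \<Phi> * (\<Psi> oo W)"
    by (simp add: has_fps_expansion_cong)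
  moreover have "F has_fps_expansion Abs_fps a"
    by (rule has_fps_expansion_of_sums[of 1]) (use assms(11) in auto)
  ultimately have "Abs_fps a = \<Phi> * (\<Psi> oo W)"
    using fps_expansion_unique_complex by blast
  then have "a p = (\<Sum>m = 0..p. fps_nth (\<Psi> oo W) m * fps_nth \<Phi> (p - m))" for p
    by (metis fps_nth_Abs_fps fps_mult_nth mult.commute)
  have bell: "fps_nth (\<Psi> oo W) m = (\<Sum>k = 1..m. \<beta> k * ordinary_bell m k c)" if "m \<ge> 1" for m
  proof -
    \<comment> \<open>Bell polynomials never read their sequence at 0, where \<open>W\<close> and \<open>c\<close> may differ.\<close>
    have "ordinary_bell m k (fps_nth W) = ordinary_bell m k c" for k
      by (auto simp: ordinary_bell_def W_def intro!: sum.cong prod.cong)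
    then have "fps_nth (W ^ k) m = ordinary_bell m k c" if "k \<le> m" for k
      using that by (simp add: fps_power_nth_eq_ordinary_bell W_def)
    moreover have "fps_nth (\<Psi> oo W) m = (\<Sum>k = 1..m. \<beta> k * fps_nth (W ^ k) m)"
      using that by (simp add: fps_compose_nth \<Psi>_def sum.atLeast_Suc_atMost)
    ultimately show ?thesis by simp
  qed
  have a: "a p = \<alpha> p * \<beta> 0 +
       (\<Sum>m = 1..p - 1. \<Sum>k = 1..m. \<alpha> (p - m) * \<beta> k * ordinary_bell m k c)" if "p \<ge> 1" for p
  proof -
    have "a p = (\<Sum>m = 0..p. fps_nth (\<Psi> oo W) m * fps_nth \<Phi> (p - m))" by fact
    also have "\<dots> = \<beta> 0 * \<alpha> p + (\<Sum>m = 1..p. fps_nth (\<Psi> oo W) m * fps_nth \<Phi> (p - m))"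
      using that by (subst sum.atLeast_Suc_atMost) (simp_all add: \<Phi>_def \<Psi>_def)
    \<comment> \<open>The term \<open>m = p\<close> carries the constant coefficient of \<open>\<Phi>\<close>, which is 0.\<close>
    also have "(\<Sum>m = 1..p. fps_nth (\<Psi> oo W) m * fps_nth \<Phi> (p - m)) =
        (\<Sum>m = 1..p - 1. fps_nth (\<Psi> oo W) m * fps_nth \<Phi> (p - m))"
      by (rule sum.mono_neutral_right) (auto simp: \<Phi>_def)
    also have "\<dots> = (\<Sum>m = 1..p - 1. \<Sum>k = 1..m. \<alpha> (p - m) * \<beta> k * ordinary_bell m k c)"
      by (rule sum.cong) (auto simp: bell \<Phi>_def sum_distrib_left sum_distrib_right mult_ac)
    finally show ?thesis by (simp add: mult.commute)
  qed
  show ?thesis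
    using a[of 1] a assms(12) by auto
qed

end
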